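(* Let $G$ be an infinite, involution free group and let $F$ be a nontrivial (i.e. having at least one edge), locally finite graph with $|V(F)|=|G|$. Then there exists a $G$-regular solution to the Generalized Oberwolfach problem $OP(F)$.
   Context: Graphs are simple and without loops, finite or infinite; set theory is ZFC. $V(\Lambda)$ and $E(\Lambda)$ denote the vertex set and edge set of a graph $\Lambda$, and $\mathbb{K}_V$ is the complete graph with vertex set $V$. A graph is locally finite if each of its vertices has finite degree. A group (written additively, not necessarily abelian) is involution free if it has no element of order $2$. A spanning subgraph of $\Lambda$ is a subgraph with the same vertex set as $\Lambda$ (it may have isolated vertices). A solution to the Generalized $OP(F)$ is a set $\mathcal{C}$ of spanning subgraphs of $\mathbb{K}_V$, where $V$ is a set with $|V|=|V(F)|$, such that each member of $\mathcal{C}$ is isomorphic to $F$ and each edge of $\mathbb{K}_V$ belongs to exactly one member of $\mathcal{C}$. Such a $\mathcal{C}$ is $G$-regular if it admits $G$ as an automorphism group acting sharply transitively on the vertices, i.e. there is a sharply transitive action of $G$ on $V$ such that, for all $g\in G$ and $B\in\mathcal{C}$, the image of $B$ under $g$ belongs to $\mathcal{C}$. *)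

theory Defs
  imports
    "HOL-Library.Equipollence"
    "HOL-Algebra.Group_Action"
    "HOL-Algebra.Multiplicative_Group"
begin

text \<open>Undirected graphs, finite or infinite; \<open>simple_graph\<close> forces edges to be two-element sets
  of vertices. The predicates below are meant for simple graphs.\<close>

record 'v sgraph =
  verts :: "'v set"
  edges :: "'v set set"

definition simple_graph :: "'v sgraph \<Rightarrow> bool" where
  "simple_graph F \<longleftrightarrow> (\<forall>e\<in>edges F. e \<subseteq> verts F \<and> card e = 2)"

definition locally_finite :: "'v sgraph \<Rightarrow> bool" where
  "locally_finite F \<longleftrightarrow> (\<forall>v\<in>verts F. finite {e \<in> edges F. v \<in> e})"

definition complete_graph :: "'v set \<Rightarrow> 'v sgraph" where
  "complete_graph V = \<lparr>verts = V, edges = {{x, y} |x y. x \<in> V \<and> y \<in> V \<and> x \<noteq> y}\<rparr>"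

definition spanning_subgraph :: "'v sgraph \<Rightarrow> 'v sgraph \<Rightarrow> bool" where
  "spanning_subgraph H K \<longleftrightarrow> simple_graph H \<and> verts H = verts K \<and> edges H \<subseteq> edges K"

text \<open>The case \<open>x = y\<close> below is harmless: simple graphs have no singleton edges.\<close>

definition graph_isomorphic :: "'v sgraph \<Rightarrow> 'w sgraph \<Rightarrow> bool" where
  "graph_isomorphic F H \<longleftrightarrow>
     (\<exists>f. bij_betw f (verts F) (verts H) \<and>
          (\<forall>x\<in>verts F. \<forall>y\<in>verts F. {x, y} \<in> edges F \<longleftrightarrow> {f x, f y} \<in> edges H))"

definition graph_image :: "('v \<Rightarrow> 'w) \<Rightarrow> 'v sgraph \<Rightarrow> 'w sgraph" where
  "graph_image f B = \<lparr>verts = f ` verts B, edges = (\<lambda>e. f ` e) ` edges B\<rparr>"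

definition OP_solution :: "'w sgraph \<Rightarrow> 'v set \<Rightarrow> 'v sgraph set \<Rightarrow> bool" where
  "OP_solution F V \<C> \<longleftrightarrow>
     V \<approx> verts F \<and>
     (\<forall>B\<in>\<C>. spanning_subgraph B (complete_graph V) \<and> graph_isomorphic B F) \<and>
     (\<forall>e\<in>edges (complete_graph V). \<exists>!B. B \<in> \<C> \<and> e \<in> edges B)"

definition involution_free :: "('g, 'm) monoid_scheme \<Rightarrow> bool" where
  "involution_free G \<longleftrightarrow> (\<forall>g\<in>carrier G. group.ord G g \<noteq> 2)"

text \<open>Actions are left actions by permutations of \<open>V\<close>. This is no loss of generality: a right
  action becomes a left action with the same orbits and stabilizers on composing with inversion.\<close>

definition sharply_transitive_action ::
    "('g, 'm) monoid_scheme \<Rightarrow> 'v set \<Rightarrow> ('g \<Rightarrow> 'v \<Rightarrow> 'v) \<Rightarrow> bool" where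
  "sharply_transitive_action G V \<phi> \<longleftrightarrow>
     group_action G V \<phi> \<and> (\<forall>x\<in>V. \<forall>y\<in>V. \<exists>!g. g \<in> carrier G \<and> \<phi> g x = y)"

definition regular_family ::
    "('g, 'm) monoid_scheme \<Rightarrow> 'v set \<Rightarrow> 'v sgraph set \<Rightarrow> bool" where
  "regular_family G V \<C> \<longleftrightarrow>
     (\<exists>\<phi>. sharply_transitive_action G V \<phi> \<and>
          (\<forall>g\<in>carrier G. \<forall>B\<in>\<C>. graph_image (\<phi> g) B \<in> \<C>))"

end

theory Submission
  imports Defs
begin

text \<open>Let \<open>G\<close> act on itself by left translations. Since \<open>G\<close> has no involutions, it acts freely on
  the edges of the complete graph, and the orbit of an edge \<open>{x, y}\<close> is determined by its
  difference \<open>x\<inverse> y\<close> up to inversion. So it suffices to find bijections \<open>f\<^sub>\<alpha>\<close> from the vertices of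
  \<open>F\<close> to \<open>G\<close>, for \<open>\<alpha>\<close> in \<open>G\<close>, such that every nontrivial element of \<open>G\<close> is the difference of
  exactly one oriented edge in exactly one of the images of \<open>F\<close>; the translates of these images
  then form the solution. The bijections are built by transfinite recursion, where at each stage fewer than \<open>|G|\<close> values have
  been assigned. Taking \<open>|G|\<close> many bijections makes a fresh one always available to realise a
  prescribed difference, and local finiteness provides an unused vertex without assigned
  neighbours to be sent to a prescribed value. The critical step is to choose the image \<open>g\<close> of a
  prescribed vertex whose neighbours already have images \<open>a, b, \<dots>\<close>: besides avoiding fewer than
  \<open>|G|\<close> values, \<open>g\<close> has to satisfy \<open>a\<inverse> g \<noteq> g\<inverse> b\<close>, which may fail for \<open>|G|\<close> many \<open>g\<close>.\<close>

section \<open>Counting in boxes\<close>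

text \<open>A corner of \<open>T\<close> is a point of \<open>T\<close> such that in each of the coordinate directions some other
  point of \<open>T\<close> lies on the line through it.\<close>

lemma card_no_corner:
  fixes T :: "('i \<Rightarrow> nat) set"
  assumes I: "finite I" and T: "T \<subseteq> (\<Pi>\<^sub>E i\<in>I. {..<N})"
    and no_corner: "\<And>n. n \<in> T \<Longrightarrow> \<exists>i\<in>I. \<forall>m. n(i := m) \<in> T \<longrightarrow> m = n i"
  shows "card T \<le> card I * N ^ (card I - 1)"
proof -
  \<comment> \<open>\<open>S i\<close> holds the points that are alone in \<open>T\<close> on their
    line in direction \<open>i\<close>. These sets cover \<open>T\<close>, and forgetting coordinate
    \<open>i\<close> is injective on \<open>S i\<close>.\<close>
  define S where "S i = {n \<in> T. \<forall>m. n(i := m) \<in> T \<longrightarrow> m = n i}" for i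
  have fin: "finite (\<Pi>\<^sub>E i\<in>J. {..<N})" if "J \<subseteq> I" for J
    using that I by (intro finite_PiE) (auto intro: finite_subset)
  have "card (S i) \<le> N ^ (card I - 1)" if i: "i \<in> I" for i
  proof -
    have "inj_on (\<lambda>n. restrict n (I - {i})) (S i)"
    proof (rule inj_onI)
      fix n n' assume n: "n \<in> S i" and n': "n' \<in> S i"
        and eq: "restrict n (I - {i}) = restrict n' (I - {i})"
      \<comment> \<open>Outside \<open>I\<close> both points take the value
        \<open>undefined\<close>, so agreement on \<open>I - {i}\<close> lets them differ only at
        \<open>i\<close>.\<close>
      have n'_eq: "n' = n(i := n' i)"
      proof
        fix k
        have "n \<in> (\<Pi>\<^sub>E i\<in>I. {..<N})" "n' \<in> (\<Pi>\<^sub>E i\<in>I. {..<N})"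
          using n n' T by (auto simp: S_def)
        then show "n' k = (n(i := n' i)) k"
          using fun_cong[OF eq, of k] by (auto simp: restrict_def PiE_def extensional_def split: if_splits)
      qed
      then have "n(i := n' i) \<in> T" using n' by (simp add: S_def)
      then have "n' i = n i" using n by (simp add: S_def)
      then show "n = n'" using n'_eq by simp
    qed
    then have "card (S i) \<le> card (\<Pi>\<^sub>E k\<in>I - {i}. {..<N})"
    proof (rule card_inj_on_le[OF _ _ fin])
      show "(\<lambda>n. restrict n (I - {i})) ` S i \<subseteq> (\<Pi>\<^sub>E k\<in>I - {i}. {..<N})"
        using T unfolding S_def by (force simp: PiE_iff)
    qed blast
    also have "\<dots> = N ^ (card I - 1)" using I i by (simp add: card_PiE)
    finally show ?thesis .
  qed
  note card_S = this
  have "T = (\<Union>i\<in>I. S i)" using no_corner by (auto simp: S_def)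
  then have "card T \<le> (\<Sum>i\<in>I. card (S i))" using I card_UN_le by auto
  also have "\<dots> \<le> (\<Sum>i\<in>I. N ^ (card I - 1))" using card_S by (rule sum_mono)
  finally show ?thesis by simp
qed

section \<open>Square roots and commuting powers\<close>

locale inv_free_group = group G for G (structure) +
  assumes involution_free: "involution_free G"
begin

lemma square_one:
  assumes x: "x \<in> carrier G" and "x \<otimes> x = \<one>"
  shows "x = \<one>"
proof (rule ccontr)
  assume "x \<noteq> \<one>"
  moreover have "x [^] (2::nat) = \<one>" using assms by (simp add: numeral_2_eq_2)
  then have "ord x dvd 2" using x pow_eq_id by blast
  then have "ord x \<le> 2" "ord x \<noteq> 0" by (auto dest: dvd_imp_le intro!: gr0I)
  then have "ord x = 1 \<or> ord x = 2" by arith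
  ultimately show False
    using involution_free x ord_eq_1 unfolding involution_free_def by auto
qed

text \<open>The order \<open>n\<close> of \<open>c = q \<otimes> q\<close> is odd, since only the
  identity squares to the identity. With \<open>n + 1 = 2 * k\<close>, every root \<open>r\<close>
  of \<open>c\<close> has \<open>r [^] n = \<one>\<close>, hence
  \<open>r = r [^] (n + 1) = c [^] k\<close>, which does not depend on \<open>r\<close>.\<close>

lemma square_root_unique:
  assumes p: "p \<in> carrier G" and q: "q \<in> carrier G" and eq: "p \<otimes> p = q \<otimes> q"
    and fin: "ord (q \<otimes> q) \<noteq> 0"
  shows "p = q"
proof -
  define c n where "c = q \<otimes> q" and "n = ord c"
  have c: "c \<in> carrier G" and cn: "c [^] n = \<one>" using q by (auto simp: c_def n_def)
  have "odd n"
  proof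
    assume "even n"
    then obtain k where k: "n = 2 * k" by blast
    then have "c [^] k \<otimes> c [^] k = \<one>" using c cn by (simp add: nat_pow_mult mult_2)
    then have "c [^] k = \<one>" using c square_one[of "c [^] k"] by simp
    then have "n dvd k" using c pow_eq_id n_def by blast
    then show False using k fin by (auto simp: n_def c_def dest: dvd_imp_le)
  qed
  then obtain k where k: "n + 1 = 2 * k" by (metis even_Suc Suc_eq_plus1 dvdE)
  have root: "r = c [^] k" if r: "r \<in> carrier G" and "r \<otimes> r = c" for r
  proof -
    have r2: "r [^] (2 * m) = c [^] m" for m :: nat
      using that nat_pow_pow[of r 2 m] by (simp add: numeral_2_eq_2)
    have "r [^] n \<otimes> r [^] n = \<one>"
      using r r2[of n] cn by (simp add: nat_pow_mult flip: mult_2)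
    then have "r [^] n = \<one>" using r square_one[of "r [^] n"] by simp
    then show ?thesis using r r2[of k] by (simp flip: k)
  qed
  show ?thesis using root[OF p] root[OF q] eq c_def by simp
qed

end

context group
begin

text \<open>Cancelling the last \<open>q\<close> shows that \<open>q\<close> conjugates
  \<open>x\<close> to its inverse, so \<open>q \<otimes> q\<close> commutes with \<open>x\<close>.
  The use is for two square roots \<open>q\<close> and \<open>x \<otimes> q\<close> of one
  element.\<close>

lemma same_square_inverts:
  assumes q: "q \<in> carrier G" and x: "x \<in> carrier G"
    and eq: "(x \<otimes> q) \<otimes> (x \<otimes> q) = q \<otimes> q"
  shows "x \<otimes> q \<otimes> x = q" and "q \<otimes> q \<otimes> x = x \<otimes> (q \<otimes> q)"
proof -
  have "(x \<otimes> q \<otimes> x) \<otimes> q = q \<otimes> q" using q x eq by (simp add: m_assoc)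
  then show *: "x \<otimes> q \<otimes> x = q" using q x by (simp)
  have "q \<otimes> q \<otimes> x = (x \<otimes> q \<otimes> x) \<otimes> q \<otimes> x" by (simp add: *)
  also have "\<dots> = x \<otimes> q \<otimes> (x \<otimes> q \<otimes> x)" using q x by (simp add: m_assoc)
  also have "\<dots> = x \<otimes> (q \<otimes> q)" using q x * by (simp add: m_assoc)
  finally show "q \<otimes> q \<otimes> x = x \<otimes> (q \<otimes> q)" .
qed

lemma commute_pow:
  assumes "x \<in> carrier G" "y \<in> carrier G" "x \<otimes> y = y \<otimes> x"
  shows "x [^] (m::nat) \<otimes> y [^] (n::nat) = y [^] n \<otimes> x [^] m"
  using assms by (metis group_commutes_pow nat_pow_closed)

text \<open>\<open>z n\<close> is the product of the powers \<open>d i [^] n i\<close> over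
  \<open>I\<close>. Only the effect of raising one exponent is recorded: this is a move along a line
  of the box.\<close>

lemma commuting_powers:
  fixes d :: "'i \<Rightarrow> 'a"
  assumes "finite I" and d: "\<And>i. i \<in> I \<Longrightarrow> d i \<in> carrier G"
    and comm: "\<And>i j. i \<in> I \<Longrightarrow> j \<in> I \<Longrightarrow> d i \<otimes> d j = d j \<otimes> d i"
  shows "\<exists>z :: ('i \<Rightarrow> nat) \<Rightarrow> 'a. (\<forall>n. z n \<in> carrier G) \<and>
    (\<forall>n i m. i \<in> I \<longrightarrow> z (n(i := n i + m)) = d i [^] m \<otimes> z n)"
proof -
  \<comment> \<open>Factors are put in front one at a time. The last conjunct keeps the old product
    unchanged while the exponent of the new factor varies.\<close>
  have "\<exists>z :: ('i \<Rightarrow> nat) \<Rightarrow> 'a. (\<forall>n. z n \<in> carrier G) \<and>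
    (\<forall>n i m. i \<in> J \<longrightarrow> z (n(i := n i + m)) = d i [^] m \<otimes> z n) \<and>
    (\<forall>n i m. i \<notin> J \<longrightarrow> z (n(i := m)) = z n)" if "J \<subseteq> I" for J
    using finite_subset[OF that \<open>finite I\<close>] that
  proof (induction J)
    case empty
    then show ?case by (intro exI[of _ "\<lambda>_. \<one>"]) auto
  next
    case (insert j J)
    then obtain z :: "('i \<Rightarrow> nat) \<Rightarrow> 'a" where z: "\<And>n. z n \<in> carrier G"
      "\<And>n i m. i \<in> J \<Longrightarrow> z (n(i := n i + m)) = d i [^] m \<otimes> z n"
      "\<And>n i m. i \<notin> J \<Longrightarrow> z (n(i := m)) = z n"
      by blast
    have dj: "d j \<in> carrier G" using insert.prems d by simp
    have swap: "d j [^] (k::nat) \<otimes> (d i [^] (m::nat) \<otimes> z n) = d i [^] m \<otimes> (d j [^] k \<otimes> z n)"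
      if "i \<in> J" for i k m n
    proof -
      have i: "d i \<in> carrier G" "d i \<otimes> d j = d j \<otimes> d i"
        using that insert.prems d comm by auto
      show ?thesis using commute_pow[OF i(1) dj i(2), of m k] z(1) i dj
        by (simp flip: m_assoc)
    qed
    define z' where "z' n = d j [^] n j \<otimes> z n" for n
    have "z' n \<in> carrier G" for n using dj z(1) by (simp add: z'_def)
    moreover have "z' (n(i := n i + m)) = d i [^] m \<otimes> z' n" if "i \<in> insert j J" for n i m
    proof (cases "i = j")
      case True
      have "d j [^] (n j + m) = d j [^] m \<otimes> d j [^] n j"
        using dj by (simp add: nat_pow_mult add.commute)
      then show ?thesis
        using True z insert.hyps dj by (simp add: z'_def m_assoc)
    next
      case False
      then show ?thesis using that z swap by (simp add: z'_def)
    qed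
    moreover have "z' (n(i := m)) = z' n" if "i \<notin> insert j J" for n i m
      using that z by (auto simp: z'_def)
    ultimately show ?case by blast
  qed
  from this[of I] show ?thesis by blast
qed

text \<open>\<open>I\<close> is a largest subset for which the powers with some common exponent
  \<open>M\<close> commute pairwise. If \<open>c j\<close> commuted with positive powers of all
  generators, a larger common exponent would let \<open>j\<close> join \<open>I\<close>.\<close>

lemma ex_max_commuting:
  assumes J: "finite J" and c: "\<And>j. j \<in> J \<Longrightarrow> c j \<in> carrier G"
  obtains I M where "I \<subseteq> J" "(M::nat) > 0"
    "\<And>i j. i \<in> I \<Longrightarrow> j \<in> I \<Longrightarrow> c i [^] M \<otimes> c j [^] M = c j [^] M \<otimes> c i [^] M"
    "\<And>j m. j \<in> J - I \<Longrightarrow> \<forall>i\<in>I. (m i::nat) > 0 \<Longrightarrow>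
       \<exists>i\<in>I. c j \<otimes> (c i [^] M) [^] m i \<noteq> (c i [^] M) [^] m i \<otimes> c j"
proof -
  define P where "P I M \<longleftrightarrow> I \<subseteq> J \<and> (M::nat) > 0 \<and>
    (\<forall>i\<in>I. \<forall>j\<in>I. c i [^] M \<otimes> c j [^] M = c j [^] M \<otimes> c i [^] M)" for I M
  have "\<exists>M. P {} M" unfolding P_def by auto
  moreover have "\<forall>I. (\<exists>M. P I M) \<longrightarrow> card I < Suc (card J)"
    unfolding P_def using J by (meson card_mono less_Suc_eq_le)
  ultimately obtain I where I: "\<exists>M. P I M" and max: "\<And>I'. \<exists>M. P I' M \<Longrightarrow> card I' \<le> card I"
    using ex_has_greatest_nat[of "\<lambda>I. \<exists>M. P I M" "{}" card "Suc (card J)"] by (auto simp: less_imp_le)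
  from I obtain M where M: "P I M" by blast
  have finI: "finite I" using M J finite_subset P_def by blast
  show ?thesis
  proof (rule that[of I M])
    show "I \<subseteq> J" "M > 0" using M by (auto simp: P_def)
    show "c i [^] M \<otimes> c j [^] M = c j [^] M \<otimes> c i [^] M" if "i \<in> I" "j \<in> I" for i j
      using M that by (auto simp: P_def)
    show "\<exists>i\<in>I. c j \<otimes> (c i [^] M) [^] m i \<noteq> (c i [^] M) [^] m i \<otimes> c j"
      if j: "j \<in> J - I" and m: "\<forall>i\<in>I. (m i::nat) > 0" for j m
    proof (rule ccontr)
      assume "\<not> ?thesis"
      then have comm: "c j \<otimes> (c i [^] M) [^] m i = (c i [^] M) [^] m i \<otimes> c j" if "i \<in> I" for i
        using that by blast
      \<comment> \<open>A multiple of \<open>M\<close> and of every \<open>M * m i\<close>, so all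
        the known commutations pass to \<open>M'\<close>-th powers.\<close>
      define M' where "M' = M * prod m I"
      have cI: "c i \<in> carrier G" if "i \<in> I" for i using M that c P_def by blast
      have cj: "c j \<in> carrier G" using j c by blast
      have M'0: "M' > 0" using M m by (simp add: M'_def P_def prod_pos)
      have 1: "c i [^] M' \<otimes> c k [^] M' = c k [^] M' \<otimes> c i [^] M'" if "i \<in> I" "k \<in> I" for i k
        using commute_pow[of "c i [^] M" "c k [^] M" "prod m I" "prod m I"] M that cI
        by (simp add: M'_def nat_pow_pow P_def)
      have 2: "c j [^] M' \<otimes> c i [^] M' = c i [^] M' \<otimes> c j [^] M'" if i: "i \<in> I" for i
      proof -
        have "M' = M * m i * prod m (I - {i})"
          using finI i by (simp add: M'_def prod.remove)
        then show ?thesis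
          using commute_pow[OF cj _ comm[OF i], of M' "prod m (I - {i})"] cI[OF i]
          by (simp add: nat_pow_pow)
      qed
      have "P (insert j I) M'"
        unfolding P_def using M'0 1 2 j M by (auto simp: P_def)
      then have "card (insert j I) \<le> card I" using max by blast
      then show False using j finI by simp
    qed
  qed
qed

end

section \<open>Cardinalities\<close>

unbundle cardinal_syntax

lemma lesspoll_iff_ordLess: "A \<prec> B \<longleftrightarrow> |A| <o |B|"
  unfolding lesspoll_def lepoll_def eqpoll_iff_card_of_ordIso card_of_ordLeq
  using not_ordLess_ordIso ordLeq_iff_ordLess_or_ordIso ordLess_imp_ordLeq by blast

lemma lepoll_iff_ordLeq: "A \<lesssim> B \<longleftrightarrow> |A| \<le>o |B|"
  by (simp add: lepoll_def card_of_ordLeq)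

lemma ex_notin_lesspoll: "S \<prec> T \<Longrightarrow> \<exists>x\<in>T. x \<notin> S"
  by (meson lesspoll_not_refl lesspoll_trans1 subsetI subset_imp_lepoll)

lemma lesspoll_Un:
  assumes "infinite C" "A \<prec> C" "B \<prec> C"
  shows "A \<union> B \<prec> C"
  using assms card_of_Un_ordLess_infinite unfolding lesspoll_iff_ordLess by blast

lemma Times_lesspoll_if_lepoll:
  assumes C: "infinite C" and AD: "A \<lesssim> D" and BD: "B \<lesssim> D" and DC: "D \<prec> C"
  shows "A \<times> B \<prec> C"
proof -
  have AB: "A \<times> B \<lesssim> D \<times> D" using AD BD times_lepoll_mono by blast
  show ?thesis
  proof (cases "finite D")
    case True
    then have "D \<times> D \<prec> C" by (intro finite_lesspoll_infinite C finite_cartesian_product)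
    then show ?thesis using AB lesspoll_trans1 by blast
  next
    case False
    then have "D \<times> D \<approx> D"
      using card_of_Times_same_infinite eqpoll_iff_card_of_ordIso by blast
    then show ?thesis using AB DC by (meson lepoll_trans2 lesspoll_trans1)
  qed
qed

lemma lesspoll_Times:
  assumes "infinite C" "A \<prec> C" "B \<prec> C"
  shows "A \<times> B \<prec> C"
proof -
  have "A \<lesssim> B \<or> B \<lesssim> A"
    using ordLeq_total[OF card_of_Well_order card_of_Well_order] by (auto simp: lepoll_iff_ordLeq)
  then show ?thesis
    using assms Times_lesspoll_if_lepoll[of C A B B] Times_lesspoll_if_lepoll[of C A A B] by auto
qed

section \<open>Avoiding square roots\<close>

context inv_free_group
begin

text \<open>If \<open>g a\<inverse> g = b\<close>, then \<open>g a\<inverse>\<close> is a square root of \<open>c = b a\<inverse>\<close>. When \<open>c\<close> has infinite order it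
  may have as many roots as \<open>G\<close> has elements, so the bad \<open>g\<close> cannot be excluded by cardinality.
  Instead, take powers of as many of the elements \<open>c\<close> as possible that commute pairwise, and look at
  a box of products of their powers, translated by some \<open>g\<^sub>0\<close>. Two bad elements for the same \<open>c\<close>
  differing by a power \<open>d\<close> of one generator give a root of \<open>c\<close> that inverts \<open>d\<close>, so that \<open>c\<close>
  commutes with \<open>d\<close>. A corner of bad elements would thus make \<open>c\<close> commute with powers of all
  generators; by maximality \<open>c\<close> is then one of the generators, and a root of \<open>c\<close> cannot invert a
  power of \<open>c\<close>. Without corners, the bad elements do not fill a large box.\<close>

lemma ex_avoiding:
  assumes inf: "infinite (carrier G)" and A: "finite A" "A \<subseteq> carrier G"
    and E: "E \<prec> carrier G"
  obtains g where "g \<in> carrier G" "g \<notin> E"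
    "\<And>a b. a \<in> A \<Longrightarrow> b \<in> A \<Longrightarrow> a \<noteq> b \<Longrightarrow> g \<otimes> inv a \<otimes> g \<noteq> b"
proof -
  define K where "K = {(a, b). a \<in> A \<and> b \<in> A \<and> a \<noteq> b}"
  define bad where "bad k g \<longleftrightarrow> g \<otimes> inv (fst k) \<otimes> g = snd k" for k g
  define c where "c k = snd k \<otimes> inv (fst k)" for k
  \<comment> \<open>\<open>ord\<close> is 0 for infinite order, so \<open>J\<close> collects the
    pairs that may have infinitely many bad \<open>g\<close>.\<close>
  define J where "J = {k \<in> K. ord (c k) = 0}"
  have "K \<subseteq> A \<times> A" by (auto simp: K_def)
  then have finK: "finite K" using A finite_subset by blast
  then have finJ: "finite J" by (simp add: J_def)
  have KG: "fst k \<in> carrier G" "snd k \<in> carrier G" if "k \<in> K" for k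
    using that A by (auto simp: K_def)
  have cG: "c k \<in> carrier G" if "k \<in> K" for k using KG[OF that] by (simp add: c_def)
  have badD: "(g \<otimes> inv (fst k)) \<otimes> (g \<otimes> inv (fst k)) = c k"
    if "k \<in> K" "g \<in> carrier G" "bad k g" for k g
    using that KG[OF that(1)] by (simp add: bad_def c_def flip: m_assoc)
  \<comment> \<open>A pair outside \<open>J\<close> has at most one bad \<open>g\<close>, by
    uniqueness of square roots, so these \<open>g\<close> can be avoided by cardinality.\<close>
  define E' where "E' = E \<union> (\<Union>k\<in>K - J. {g \<in> carrier G. bad k g})"
  have "finite {g \<in> carrier G. bad k g}" if k: "k \<in> K - J" for k
  proof -
    have "g = h" if "g \<in> carrier G" "bad k g" "h \<in> carrier G" "bad k h" for g h
    proof -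
      have "k \<in> K" "ord (c k) \<noteq> 0" using k by (auto simp: J_def)
      then have "g \<otimes> inv (fst k) = h \<otimes> inv (fst k)"
        using that KG[of k] badD[of k g] badD[of k h]
        by - (rule square_root_unique, simp_all)
      then show ?thesis using KG[of k] k that by simp
    qed
    then have "\<exists>h. {g \<in> carrier G. bad k g} \<subseteq> {h}" by blast
    then show ?thesis using finite_subset by blast
  qed
  then have "E' \<prec> carrier G"
    unfolding E'_def using finK by (intro lesspoll_Un finite_lesspoll_infinite inf E) auto
  have "\<exists>g\<in>carrier G. g \<notin> E' \<and> (\<forall>j\<in>J. \<not> bad j g)"
  proof (cases "J = {}")
    case True
    then show ?thesis using ex_notin_lesspoll[OF \<open>E' \<prec> carrier G\<close>] by blast
  next
    case False
    have cJ: "c j \<in> carrier G" if "j \<in> J" for j using that cG by (simp add: J_def)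
    obtain I M where IJ: "I \<subseteq> J" and M: "(M::nat) > 0"
      and comm: "\<And>i j. i \<in> I \<Longrightarrow> j \<in> I \<Longrightarrow> c i [^] M \<otimes> c j [^] M = c j [^] M \<otimes> c i [^] M"
      and max: "\<And>j m. j \<in> J - I \<Longrightarrow> \<forall>i\<in>I. (m i::nat) > 0 \<Longrightarrow>
         \<exists>i\<in>I. c j \<otimes> (c i [^] M) [^] m i \<noteq> (c i [^] M) [^] m i \<otimes> c j"
      using ex_max_commuting[OF finJ, of c] cJ by metis
    \<comment> \<open>For empty \<open>I\<close>, maximality applied to any \<open>j\<close> in
      \<open>J\<close> would produce a member of \<open>I\<close>. The box thus has positive
      dimension.\<close>
    have I0: "I \<noteq> {}" using max[of _ "\<lambda>_. 1"] False by fastforce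
    have finI: "finite I" using IJ finJ finite_subset by blast
    have dI: "c i [^] M \<in> carrier G" if "i \<in> I" for i using that IJ cJ[of i] by auto
    obtain z where zG: "\<And>n. z n \<in> carrier G"
      and z: "\<And>n i m. i \<in> I \<Longrightarrow> z (n(i := n i + m)) = (c i [^] M) [^] (m::nat) \<otimes> z n"
      using commuting_powers[OF finI, of "\<lambda>i. c i [^] M"] dI comm by blast
    \<comment> \<open>Large enough that \<open>card J\<close> sets of at most
      \<open>card I * N ^ (card I - 1)\<close> points each cannot cover the
      \<open>N ^ card I\<close> points of the box.\<close>
    define N where "N = Suc (card J * card I)"
    define B where "B = (\<Pi>\<^sub>E i\<in>I. {..<N})"
    have finB: "finite B" using finI by (simp add: B_def finite_PiE)
    \<comment> \<open>Excluding the products \<open>inv (z n) \<otimes> e\<close> moves the whole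
      translated box off \<open>E'\<close> at once.\<close>
    have "(\<lambda>(x, e). inv x \<otimes> e) ` (z ` B \<times> E') \<prec> carrier G"
      by (intro lesspoll_trans1[OF image_lepoll] lesspoll_Times inf \<open>E' \<prec> carrier G\<close>
          finite_lesspoll_infinite finite_imageI finB)
    from ex_notin_lesspoll[OF this] obtain g0 where g0: "g0 \<in> carrier G"
      and g0E: "g0 \<notin> (\<lambda>(x, e). inv x \<otimes> e) ` (z ` B \<times> E')"
      by blast
    define T where "T j = {n \<in> B. bad j (z n \<otimes> g0)}" for j
    have card_T: "card (T j) \<le> card I * N ^ (card I - 1)" if j: "j \<in> J" for j
    proof (rule card_no_corner[OF finI])
      show "T j \<subseteq> (\<Pi>\<^sub>E i\<in>I. {..<N})" by (auto simp: T_def B_def)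
      fix n assume n: "n \<in> T j"
      show "\<exists>i\<in>I. \<forall>m. n(i := m) \<in> T j \<longrightarrow> m = n i"
      proof (rule ccontr)
        assume contr: "\<not> ?thesis"
        \<comment> \<open>On \<open>T j\<close> this is a square root of \<open>c j\<close>; a move
          in direction \<open>i\<close> multiplies it on the left by a power of the
          generator.\<close>
        define p where "p n = z n \<otimes> g0 \<otimes> inv (fst j)" for n
        have jK: "j \<in> K" using j by (simp add: J_def)
        have pG: "p n \<in> carrier G" for n using zG g0 KG[OF jK] by (simp add: p_def)
        have p_sq: "p n \<otimes> p n = c j" if "n \<in> T j" for n
          unfolding p_def using that zG g0 by (intro badD jK) (auto simp: T_def)
        have p_step: "p (n(i := n i + m)) = (c i [^] M) [^] m \<otimes> p n" if "i \<in> I" for n i m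
          using that z zG g0 KG[OF jK] dI by (simp add: p_def m_assoc)
        have "\<exists>m q. (m::nat) > 0 \<and> q \<in> carrier G \<and> q \<otimes> q = c j \<and>
          ((c i [^] M) [^] m \<otimes> q) \<otimes> ((c i [^] M) [^] m \<otimes> q) = q \<otimes> q" if i: "i \<in> I" for i
        proof -
          obtain k where k: "n(i := k) \<in> T j" "k \<noteq> n i" using contr i by blast
          \<comment> \<open>The second point may lie on either side of \<open>n\<close>, so
            \<open>a\<close> and \<open>b\<close> are the two coordinates in increasing order. The
            root \<open>q\<close> is taken at \<open>a\<close>, with
            \<open>m = b - a\<close>.\<close>
          have *: ?thesis if "a < b" "n(i := a) \<in> T j" "n(i := b) \<in> T j" for a b
          proof (intro exI conjI)
            show "p (n(i := a)) \<otimes> p (n(i := a)) = c j" using p_sq that by blast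
            have "p (n(i := b)) = (c i [^] M) [^] (b - a) \<otimes> p (n(i := a))"
              using p_step[OF i, of "n(i := a)" "b - a"] that by simp
            then show "(c i [^] M) [^] (b - a) \<otimes> p (n(i := a)) \<otimes>
                ((c i [^] M) [^] (b - a) \<otimes> p (n(i := a))) = p (n(i := a)) \<otimes> p (n(i := a))"
              using p_sq that by metis
          qed (use that pG in simp_all)
          have "n(i := n i) \<in> T j" using n by simp
          then show ?thesis using * k by (meson linorder_neqE_nat)
        qed
        then obtain m q where m: "\<And>i. i \<in> I \<Longrightarrow> (m i::nat) > 0"
          and q: "\<And>i. i \<in> I \<Longrightarrow> q i \<in> carrier G" "\<And>i. i \<in> I \<Longrightarrow> q i \<otimes> q i = c j"
            "\<And>i. i \<in> I \<Longrightarrow> ((c i [^] M) [^] m i \<otimes> q i) \<otimes> ((c i [^] M) [^] m i \<otimes> q i) = q i \<otimes> q i"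
          by metis
        have xG: "(c i [^] M) [^] m i \<in> carrier G" if "i \<in> I" for i using dI[OF that] by simp
        have inverts: "(c i [^] M) [^] m i \<otimes> q i \<otimes> (c i [^] M) [^] m i = q i"
          and commutes: "c j \<otimes> (c i [^] M) [^] m i = (c i [^] M) [^] m i \<otimes> c j" if "i \<in> I" for i
          using same_square_inverts[OF q(1) xG q(3), OF that that that] q(2)[OF that] by auto
        have "j \<in> I" using max[of j m] j m commutes by blast
        define x where "x = c j [^] (M * m j)"
        have x: "x = (c j [^] M) [^] m j" using cJ[OF j] by (simp add: x_def nat_pow_pow)
        have [simp]: "x \<in> carrier G" "q j \<in> carrier G" using cJ j q \<open>j \<in> I\<close> by (auto simp: x_def)
        \<comment> \<open>The root \<open>q j\<close> inverts \<open>x\<close>, but it also commutes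
          with its square \<open>c j\<close> and hence with the power \<open>x\<close>. So
          \<open>x\<close> squares to the identity and is trivial, although \<open>c j\<close> has
          infinite order.\<close>
        have "c j \<otimes> q j = q j \<otimes> c j" using q(2)[OF \<open>j \<in> I\<close>] by (metis \<open>q j \<in> carrier G\<close> m_assoc)
        then have "x \<otimes> q j = q j \<otimes> x"
          using commute_pow[of "c j" "q j" "M * m j" 1] cJ j by (simp add: x_def)
        then have "x \<otimes> x \<otimes> q j = q j" using inverts[OF \<open>j \<in> I\<close>] by (simp add: m_assoc flip: x)
        then have "x \<otimes> x = \<one>" by simp
        then have "x = \<one>" using square_one[of x] by simp
        then have "ord (c j) dvd M * m j" using cJ[OF j] pow_eq_id by (simp add: x_def)
        then show False using j M m[OF \<open>j \<in> I\<close>] by (simp add: J_def)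
      qed
    qed
    have "card (\<Union>j\<in>J. T j) \<le> (\<Sum>j\<in>J. card (T j))" using finJ by (rule card_UN_le)
    also have "\<dots> \<le> (\<Sum>j\<in>J. card I * N ^ (card I - 1))" using card_T by (rule sum_mono)
    also have "\<dots> < N * N ^ (card I - 1)" by (simp add: N_def)
    also have "\<dots> = card B"
      using finI I0 by (simp add: B_def card_PiE card_gt_0_iff flip: power_Suc)
    finally have "\<not> B \<subseteq> (\<Union>j\<in>J. T j)"
      using card_mono[of "\<Union>j\<in>J. T j" B] finB finJ by (auto simp: T_def)
    then obtain n where n: "n \<in> B" "\<And>j. j \<in> J \<Longrightarrow> n \<notin> T j" by blast
    have "z n \<otimes> g0 \<notin> E'"
    proof
      assume *: "z n \<otimes> g0 \<in> E'"
      have "g0 = inv (z n) \<otimes> (z n \<otimes> g0)" using zG g0 by (simp flip: m_assoc)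
      then show False using g0E * n(1) by force
    qed
    then show ?thesis using n zG g0 by (intro bexI[of _ "z n \<otimes> g0"]) (auto simp: T_def)
  qed
  then obtain g where g: "g \<in> carrier G" "g \<notin> E'" "\<forall>j\<in>J. \<not> bad j g" by blast
  show ?thesis
  proof (rule that[OF g(1)])
    show "g \<notin> E" using g by (simp add: E'_def)
    show "g \<otimes> inv a \<otimes> g \<noteq> b" if "a \<in> A" "b \<in> A" "a \<noteq> b" for a b
    proof -
      have "(a, b) \<in> K" using that by (simp add: K_def)
      then have "\<not> bad (a, b) g" using g by (auto simp: E'_def)
      then show ?thesis by (simp add: bad_def)
    qed
  qed
qed

end

section \<open>Transfinite extension\<close>

text \<open>An infinite index set absorbs finite members, so the union is no larger than
  \<open>I\<close>; this works for singular cardinals as well.\<close>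

lemma finite_UN_lesspoll:
  assumes C: "infinite C" and I: "I \<prec> C" and fin: "\<And>i. i \<in> I \<Longrightarrow> finite (A i)"
  shows "(\<Union>i\<in>I. A i) \<prec> C"
proof (cases "finite I")
  case True
  then show ?thesis using fin by (intro finite_lesspoll_infinite C) auto
next
  case False
  have "A i \<lesssim> I" if "i \<in> I" for i using that fin False by (intro finite_lepoll_infinite)
  then have "(\<Union>i\<in>I. A i) \<lesssim> I"
    unfolding lepoll_iff_ordLeq
    by (intro card_of_UNION_ordLeq_infinite False ballI ordLeq_refl card_of_Card_order)
  then show ?thesis using I lesspoll_trans1 by blast
qed

text \<open>The requirements in \<open>R\<close> are met along a well-order of type
  \<open>|R|\<close>. Every proper initial segment is smaller than \<open>R\<close> and each stage
  adds finitely many points, so \<open>step\<close> always applies. By \<open>mono\<close> a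
  requirement stays met.\<close>

lemma transfinite_extension:
  fixes R :: "'r set" and valid :: "'x set \<Rightarrow> bool"
  assumes inf: "infinite R"
    and union: "\<And>\<X>. (\<And>X Y. X \<in> \<X> \<Longrightarrow> Y \<in> \<X> \<Longrightarrow> X \<subseteq> Y \<or> Y \<subseteq> X) \<Longrightarrow>
      (\<And>X. X \<in> \<X> \<Longrightarrow> valid X) \<Longrightarrow> valid (\<Union>\<X>)"
    and step: "\<And>P r. valid P \<Longrightarrow> P \<prec> R \<Longrightarrow> r \<in> R \<Longrightarrow>
      \<exists>Q. finite Q \<and> valid (P \<union> Q) \<and> sat r (P \<union> Q)"
    and mono: "\<And>r P P'. sat r P \<Longrightarrow> P \<subseteq> P' \<Longrightarrow> sat r P'"
  obtains P where "valid P" "\<And>r. r \<in> R \<Longrightarrow> sat r P"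
proof -
  let ?o = "|R|"
  have wo: "Well_order ?o" by (rule card_of_Well_order)
  have [simp]: "Field ?o = R" by (rule Field_card_of)
  have wf: "wf (?o - Id)" using wo well_order_on_def by blast
  have total: "a \<in> R \<Longrightarrow> b \<in> R \<Longrightarrow> (a, b) \<in> ?o \<or> (b, a) \<in> ?o" for a b
    using wo wo_rel.TOTALS[of ?o] by (auto simp: wo_rel_def)
  have trans: "(a, b) \<in> ?o \<Longrightarrow> (b, c) \<in> ?o \<Longrightarrow> (a, c) \<in> ?o" for a b c
    using wo wo_rel.TRANS[of ?o] by (auto simp: wo_rel_def trans_def)
  have refl: "a \<in> R \<Longrightarrow> (a, a) \<in> ?o" for a using total by blast
  have field: "a \<in> R" "b \<in> R" if "(a, b) \<in> ?o" for a b
    using that FieldI1[of a b ?o] FieldI2[of a b ?o] by auto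
  \<comment> \<open>\<open>f y\<close> is only the finite increment of stage \<open>y\<close>;
    \<open>below f x\<close> is all that was added before stage \<open>x\<close>.\<close>
  define below where "below f x = (\<Union>y\<in>underS ?o x. f y)" for f :: "'r \<Rightarrow> 'x set" and x
  define good where "good f x Q \<longleftrightarrow>
    (x \<in> R \<longrightarrow> finite Q \<and> valid (below f x \<union> Q) \<and> sat x (below f x \<union> Q))" for f x Q
  \<comment> \<open>Used for the segment below a stage and for all of \<open>R\<close>. The sets
    reached after the stages in \<open>S\<close> form a chain with the required union.\<close>
  have valid_UN: "valid (\<Union>y\<in>S. f y)"
    if S: "S \<subseteq> R" "\<And>x y. y \<in> S \<Longrightarrow> (x, y) \<in> ?o \<Longrightarrow> x \<in> S"
      and good: "\<And>y. y \<in> S \<Longrightarrow> good f y (f y)" for S f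
  proof -
    have below_eq: "below f y \<union> f y = (\<Union>z\<in>{z. (z, y) \<in> ?o}. f z)" if "y \<in> S" for y
    proof -
      have "{z. (z, y) \<in> ?o} = insert y (underS ?o y)"
        using refl[of y] S(1) that by (auto simp: underS_def)
      then show ?thesis by (auto simp: below_def)
    qed
    have "valid (\<Union>((\<lambda>y. below f y \<union> f y) ` S))"
    proof (rule union)
      fix X Y assume "X \<in> (\<lambda>y. below f y \<union> f y) ` S" "Y \<in> (\<lambda>y. below f y \<union> f y) ` S"
      then obtain x y where xy: "x \<in> S" "y \<in> S"
        and X: "X = below f x \<union> f x" and Y: "Y = below f y \<union> f y" by blast
      have "(x, y) \<in> ?o \<or> (y, x) \<in> ?o" using total xy S(1) by blast
      then show "X \<subseteq> Y \<or> Y \<subseteq> X"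
        unfolding X Y below_eq[OF xy(1)] below_eq[OF xy(2)] using trans by blast
    next
      show "valid X" if "X \<in> (\<lambda>y. below f y \<union> f y) ` S" for X
        using that good S(1) by (auto simp: good_def)
    qed
    also have "\<Union>((\<lambda>y. below f y \<union> f y) ` S) = (\<Union>y\<in>S. f y)"
      using S by (auto simp: below_def underS_def)
    finally show ?thesis .
  qed
  have "\<exists>f. \<forall>x. good f x (f x)"
  proof (rule dependent_wf_choice[OF wf])
    fix f g :: "'r \<Rightarrow> 'x set" and x Q
    assume "\<And>y. (y, x) \<in> ?o - Id \<Longrightarrow> f y = g y"
    then have "below f x = below g x" by (auto simp: below_def underS_def)
    then show "good f x Q = good g x Q" by (simp add: good_def)
  next
    fix x f assume IH: "\<And>y. (y, x) \<in> ?o - Id \<Longrightarrow> good f y (f y)"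
    show "\<exists>Q. good f x Q"
    proof (cases "x \<in> R")
      case True
      have "valid (below f x)"
        unfolding below_def
      proof (rule valid_UN)
        show "underS ?o x \<subseteq> R" using field by (auto simp: underS_def)
        show "y \<in> underS ?o x" if "z \<in> underS ?o x" "(y, z) \<in> ?o" for y z
          using that trans[of y z x] wo wo_rel.ANTISYM[of ?o]
          by (auto simp: underS_def wo_rel_def antisym_def)
        show "good f y (f y)" if "y \<in> underS ?o x" for y using that IH by (auto simp: underS_def)
      qed
      moreover have "below f x \<prec> R"
        unfolding below_def
      proof (rule finite_UN_lesspoll[OF inf])
        show "underS ?o x \<prec> R"
          unfolding lesspoll_iff_ordLess using True by (intro card_of_underS card_of_Card_order) simp
        show "finite (f y)" if "y \<in> underS ?o x" for y
          using that IH field by (auto simp: underS_def good_def)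
      qed
      ultimately show ?thesis using step[OF _ _ True] by (auto simp: good_def)
    qed (simp add: good_def)
  qed
  then obtain f where f: "\<And>x. good f x (f x)" by blast
  show ?thesis
  proof (rule that)
    show "valid (\<Union>y\<in>R. f y)" by (rule valid_UN) (use field f in auto)
    show "sat r (\<Union>y\<in>R. f y)" if "r \<in> R" for r
    proof (rule mono)
      show "sat r (below f r \<union> f r)" using f[of r] that by (simp add: good_def)
      show "below f r \<union> f r \<subseteq> (\<Union>y\<in>R. f y)" using that field by (auto simp: below_def underS_def)
    qed
  qed
qed

section \<open>The base blocks\<close>

locale oberwolfach = inv_free_group G for G :: "('g, 'm) monoid_scheme" (structure) +
  fixes F :: "'w sgraph"
  assumes infinite_G: "infinite (carrier G)"
    and simple: "simple_graph F"
    and nontrivial: "edges F \<noteq> {}"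
    and loc_fin: "locally_finite F"
    and size: "verts F \<approx> carrier G"
begin

lemma edge_verts: "{u, v} \<in> edges F \<Longrightarrow> u \<in> verts F \<and> v \<in> verts F \<and> u \<noteq> v"
  using simple unfolding simple_graph_def by (metis card_2_iff doubleton_eq_iff insert_subset)

lemma finite_nbrs: "finite {v. {u, v} \<in> edges F}"
proof (cases "u \<in> verts F")
  case True
  have "(\<lambda>v. {u, v}) ` {v. {u, v} \<in> edges F} \<subseteq> {e \<in> edges F. u \<in> e}" by auto
  moreover have "finite {e \<in> edges F. u \<in> e}" using loc_fin True by (simp add: locally_finite_def)
  ultimately have "finite ((\<lambda>v. {u, v}) ` {v. {u, v} \<in> edges F})" by (rule finite_subset)
  then show ?thesis by (rule finite_imageD) (auto simp: inj_on_def doubleton_eq_iff)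
next
  case False
  then have "{v. {u, v} \<in> edges F} = {}" using edge_verts by blast
  then show ?thesis by simp
qed

text \<open>A set of triples encodes a family of partial embeddings of \<open>F\<close> into \<open>G\<close> indexed by \<open>G\<close>:
  \<open>(\<alpha>, v, a)\<close> says that the embedding with index \<open>\<alpha>\<close> sends \<open>v\<close> to \<open>a\<close>.\<close>

definition diffs :: "('g \<times> 'w \<times> 'g) set \<Rightarrow> ('g \<times> 'w \<times> 'w \<times> 'g) set" where
  "diffs P = {(\<alpha>, u, v, inv a \<otimes> b) |\<alpha> u v a b.
     (\<alpha>, u, a) \<in> P \<and> (\<alpha>, v, b) \<in> P \<and> {u, v} \<in> edges F}"

abbreviation diff_val :: "'g \<times> 'w \<times> 'w \<times> 'g \<Rightarrow> 'g" where
  "diff_val \<equiv> \<lambda>(\<alpha>, u, v, d). d"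

text \<open>As \<open>diffs\<close> keeps index and endpoints, injectivity of
  \<open>diff_val\<close> says that no difference is repeated, within one embedding or across two.
  Both orientations of an edge count, so a difference may not be the inverse of one from another
  edge either.\<close>

definition valid :: "('g \<times> 'w \<times> 'g) set \<Rightarrow> bool" where
  "valid P \<longleftrightarrow> P \<subseteq> carrier G \<times> verts F \<times> carrier G \<and>
     (\<forall>\<alpha> u a b. (\<alpha>, u, a) \<in> P \<longrightarrow> (\<alpha>, u, b) \<in> P \<longrightarrow> a = b) \<and>
     (\<forall>\<alpha> u v a. (\<alpha>, u, a) \<in> P \<longrightarrow> (\<alpha>, v, a) \<in> P \<longrightarrow> u = v) \<and>
     inj_on diff_val (diffs P)"

lemma diffsI:
  "(\<alpha>, u, a) \<in> P \<Longrightarrow> (\<alpha>, v, b) \<in> P \<Longrightarrow> {u, v} \<in> edges F \<Longrightarrow> (\<alpha>, u, v, inv a \<otimes> b) \<in> diffs P"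
  unfolding diffs_def by blast

lemma diffs_mono: "P \<subseteq> P' \<Longrightarrow> diffs P \<subseteq> diffs P'"
  unfolding diffs_def by blast

lemma valid_carrier: "valid P \<Longrightarrow> (\<alpha>, u, a) \<in> P \<Longrightarrow> \<alpha> \<in> carrier G \<and> u \<in> verts F \<and> a \<in> carrier G"
  unfolding valid_def by blast

lemma diffs_swap:
  assumes "valid P" "(\<alpha>, u, v, d) \<in> diffs P"
  shows "(\<alpha>, v, u, inv d) \<in> diffs P"
proof -
  obtain a b where ab: "(\<alpha>, u, a) \<in> P" "(\<alpha>, v, b) \<in> P" "{u, v} \<in> edges F" "d = inv a \<otimes> b"
    using assms unfolding diffs_def by blast
  then have "inv d = inv b \<otimes> a"
    using valid_carrier[OF assms(1)] by (metis inv_closed inv_inv inv_mult_group)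
  then show ?thesis using diffsI[OF ab(2,1)] ab(3) by (simp add: insert_commute)
qed

text \<open>Each clause of \<open>valid\<close> concerns two triples or two differences, and these
  already occur together in one member of the chain.\<close>

lemma valid_Union:
  assumes chain: "\<And>X Y. X \<in> \<X> \<Longrightarrow> Y \<in> \<X> \<Longrightarrow> X \<subseteq> Y \<or> Y \<subseteq> X"
    and valid: "\<And>X. X \<in> \<X> \<Longrightarrow> valid X"
  shows "valid (\<Union>\<X>)"
proof -
  have pair: "\<exists>Z\<in>\<X>. p \<in> Z \<and> q \<in> Z" if "p \<in> \<Union>\<X>" "q \<in> \<Union>\<X>" for p q
    using that chain by (meson UnionE subsetD)
  have diffs: "diffs (\<Union>\<X>) = (\<Union>X\<in>\<X>. diffs X)"
  proof
    show "diffs (\<Union>\<X>) \<subseteq> (\<Union>X\<in>\<X>. diffs X)"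
    proof
      fix x assume "x \<in> diffs (\<Union>\<X>)"
      then obtain \<alpha> u v a b where x: "x = (\<alpha>, u, v, inv a \<otimes> b)" "{u, v} \<in> edges F"
        and ab: "(\<alpha>, u, a) \<in> \<Union>\<X>" "(\<alpha>, v, b) \<in> \<Union>\<X>"
        unfolding diffs_def by blast
      from pair[OF ab] obtain Z where "Z \<in> \<X>" "(\<alpha>, u, a) \<in> Z" "(\<alpha>, v, b) \<in> Z" by blast
      then show "x \<in> (\<Union>X\<in>\<X>. diffs X)" unfolding x(1) by (intro UN_I diffsI x(2))
    qed
    show "(\<Union>X\<in>\<X>. diffs X) \<subseteq> diffs (\<Union>\<X>)" using diffs_mono by blast
  qed
  have "inj_on diff_val (diffs (\<Union>\<X>))"
  proof (rule inj_onI)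
    fix x y assume "x \<in> diffs (\<Union>\<X>)" "y \<in> diffs (\<Union>\<X>)" and eq: "diff_val x = diff_val y"
    then obtain X Y where "X \<in> \<X>" "Y \<in> \<X>" "x \<in> diffs X" "y \<in> diffs Y" unfolding diffs by blast
    then obtain Z where "Z \<in> \<X>" "x \<in> diffs Z" "y \<in> diffs Z"
      using chain[of X Y] diffs_mono by blast
    then show "x = y" using valid[of Z] eq unfolding valid_def inj_on_def by blast
  qed
  moreover have "a = b" if "(\<alpha>, u, a) \<in> \<Union>\<X>" "(\<alpha>, u, b) \<in> \<Union>\<X>" for \<alpha> u a b
    using pair[OF that] valid unfolding valid_def by blast
  moreover have "u = v" if "(\<alpha>, u, a) \<in> \<Union>\<X>" "(\<alpha>, v, a) \<in> \<Union>\<X>" for \<alpha> u v a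
    using pair[OF that] valid unfolding valid_def by blast
  moreover have "\<Union>\<X> \<subseteq> carrier G \<times> verts F \<times> carrier G" using valid unfolding valid_def by blast
  ultimately show ?thesis unfolding valid_def by blast
qed

text \<open>New differences come from edges between \<open>v\<close> and its assigned neighbours.
  \<open>new_diff\<close> separates them from the old ones, in both orientations because old
  differences are closed under inversion; \<open>avoid\<close> separates those directed towards
  \<open>v\<close> from those directed away from it.\<close>

lemma valid_insert:
  assumes P: "valid P" and \<alpha>: "\<alpha> \<in> carrier G" and v: "v \<in> verts F" and g: "g \<in> carrier G"
    and v_new: "\<And>a. (\<alpha>, v, a) \<notin> P" and g_new: "\<And>u. (\<alpha>, u, g) \<notin> P"
    and new_diff: "\<And>u a. (\<alpha>, u, a) \<in> P \<Longrightarrow> {u, v} \<in> edges F \<Longrightarrow> inv a \<otimes> g \<notin> diff_val ` diffs P"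
    and avoid: "\<And>u u' a b. (\<alpha>, u, a) \<in> P \<Longrightarrow> (\<alpha>, u', b) \<in> P \<Longrightarrow> {u, v} \<in> edges F \<Longrightarrow>
      {u', v} \<in> edges F \<Longrightarrow> a \<noteq> b \<Longrightarrow> g \<otimes> inv a \<otimes> g \<noteq> b"
  shows "valid (insert (\<alpha>, v, g) P)"
proof -
  define S where "S = {(u, a). (\<alpha>, u, a) \<in> P \<and> {u, v} \<in> edges F}"
  \<comment> \<open>\<open>S1\<close> has the edges directed towards \<open>v\<close>,
    \<open>S2\<close> those directed away from \<open>v\<close>.\<close>
  define S1 where "S1 = (\<lambda>(u, a). (\<alpha>, u, v, inv a \<otimes> g)) ` S"
  define S2 where "S2 = (\<lambda>(u, a). (\<alpha>, v, u, inv g \<otimes> a)) ` S"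
  have diffs: "diffs (insert (\<alpha>, v, g) P) \<subseteq> S1 \<union> S2 \<union> diffs P"
  proof
    fix x assume "x \<in> diffs (insert (\<alpha>, v, g) P)"
    then obtain \<beta> u w a b where x: "x = (\<beta>, u, w, inv a \<otimes> b)"
      and ab: "(\<beta>, u, a) \<in> insert (\<alpha>, v, g) P" "(\<beta>, w, b) \<in> insert (\<alpha>, v, g) P"
      and e: "{u, w} \<in> edges F"
      unfolding diffs_def by blast
    have "u \<noteq> w" using e edge_verts by blast
    then consider "(\<beta>, u, a) \<in> P" "(\<beta>, w, b) \<in> P" | "(\<beta>, u, a) \<in> P" "(\<beta>, w, b) = (\<alpha>, v, g)"
      | "(\<beta>, w, b) \<in> P" "(\<beta>, u, a) = (\<alpha>, v, g)"
      using ab by blast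
    then show "x \<in> S1 \<union> S2 \<union> diffs P"
    proof cases
      case 1
      then show ?thesis using diffsI[OF _ _ e] x by simp
    next
      case 2
      then have "(u, a) \<in> S" using e by (simp add: S_def)
      then show ?thesis using 2 x unfolding S1_def by force
    next
      case 3
      then have "(w, b) \<in> S" using e by (simp add: S_def insert_commute)
      then show ?thesis using 3 x unfolding S2_def by force
    qed
  qed
  have SG: "a \<in> carrier G" "a \<noteq> g" if "(u, a) \<in> S" for u a
    using that valid_carrier[OF P] g_new by (auto simp: S_def)
  have S_eq: "u = u'" if "(u, a) \<in> S" "(u', a) \<in> S" for u u' a
    using that P by (auto simp: S_def valid_def)
  have cross: "inv a \<otimes> g \<noteq> inv g \<otimes> b" if "(u, a) \<in> S" "(u', b) \<in> S" for u u' a b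
  proof
    assume eq: "inv a \<otimes> g = inv g \<otimes> b"
    have [simp]: "a \<in> carrier G" "b \<in> carrier G" "g \<in> carrier G" using that SG g by auto
    have b: "g \<otimes> inv a \<otimes> g = b" using eq by (simp add: m_assoc flip: m_assoc[of g "inv g"])
    \<comment> \<open>\<open>avoid\<close> settles distinct \<open>a\<close> and \<open>b\<close>.
      If they agree, \<open>g \<otimes> inv a\<close> squares to the identity, so
      \<open>g = a\<close>, a value already in use.\<close>
    then have "a = b" using avoid that unfolding S_def by blast
    then have "(g \<otimes> inv a) \<otimes> (g \<otimes> inv a) = \<one>" using b by (simp flip: m_assoc)
    then have "g \<otimes> inv a = \<one>" using square_one[of "g \<otimes> inv a"] by simp
    then have "g = a" using inv_equality[of g "inv a"] by simp
    then show False using SG that by blast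
  qed
  have old1: "inv a \<otimes> g \<notin> diff_val ` diffs P" if "(u, a) \<in> S" for u a
    using that new_diff unfolding S_def by blast
  have old2: "inv g \<otimes> a \<notin> diff_val ` diffs P" if "(u, a) \<in> S" for u a
  proof
    assume "inv g \<otimes> a \<in> diff_val ` diffs P"
    then obtain \<beta> w w' where "(\<beta>, w, w', inv g \<otimes> a) \<in> diffs P" by auto
    from diffs_swap[OF P this] have "inv (inv g \<otimes> a) \<in> diff_val ` diffs P" by force
    moreover have "inv (inv g \<otimes> a) = inv a \<otimes> g"
      using SG[OF that] g by (simp add: inv_mult_group)
    ultimately show False using old1[OF that] by simp
  qed
  have "inj_on diff_val (S1 \<union> S2 \<union> diffs P)"
  proof -
    have "inj_on diff_val S1"
      unfolding S1_def inj_on_def using SG S_eq g by auto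
    moreover have "inj_on diff_val S2"
      unfolding S2_def inj_on_def using SG S_eq g by auto
    moreover have "inj_on diff_val (diffs P)" using P by (simp add: valid_def)
    moreover have "diff_val ` S1 \<inter> diff_val ` S2 = {}"
      unfolding S1_def S2_def using cross by auto
    moreover have "diff_val x \<notin> diff_val ` diffs P" if x: "x \<in> S1" for x
    proof -
      obtain u a where "(u, a) \<in> S" "diff_val x = inv a \<otimes> g" using x unfolding S1_def by auto
      then show ?thesis using old1 by simp
    qed
    then have "diff_val ` S1 \<inter> diff_val ` diffs P = {}" by blast
    moreover have "diff_val x \<notin> diff_val ` diffs P" if x: "x \<in> S2" for x
    proof -
      obtain u a where "(u, a) \<in> S" "diff_val x = inv g \<otimes> a" using x unfolding S2_def by auto
      then show ?thesis using old2 by simp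
    qed
    then have "diff_val ` S2 \<inter> diff_val ` diffs P = {}" by blast
    ultimately show ?thesis unfolding inj_on_Un by blast
  qed
  then have "inj_on diff_val (diffs (insert (\<alpha>, v, g) P))" using diffs inj_on_subset by blast
  then show ?thesis using P \<alpha> v g v_new g_new unfolding valid_def by blast
qed

lemma small_diff_val:
  assumes "P \<prec> carrier G"
  shows "diff_val ` diffs P \<prec> carrier G"
proof -
  have "diff_val ` diffs P \<subseteq> (\<lambda>((\<alpha>, u, a), (\<beta>, v, b)). inv a \<otimes> b) ` (P \<times> P)"
    unfolding diffs_def by force
  then show ?thesis
    using lesspoll_Times[OF infinite_G assms assms]
    by (meson image_lepoll lepoll_trans lesspoll_trans1 subset_imp_lepoll)
qed

lemma small_insert: "P \<prec> carrier G \<Longrightarrow> insert x P \<prec> carrier G"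
  using lesspoll_Un[OF infinite_G, of "{x}" P] finite_lesspoll_infinite[OF infinite_G, of "{x}"] by simp

text \<open>By local finiteness the assigned neighbours have only finitely many values, as
  \<open>ex_avoiding\<close> demands.\<close>

lemma extend_vertex:
  assumes P: "valid P" "P \<prec> carrier G" and \<alpha>: "\<alpha> \<in> carrier G" and v: "v \<in> verts F"
  shows "\<exists>Q. finite Q \<and> valid (P \<union> Q) \<and> (\<exists>a. (\<alpha>, v, a) \<in> P \<union> Q)"
proof (cases "\<exists>a. (\<alpha>, v, a) \<in> P")
  case True
  then show ?thesis using P by (intro exI[of _ "{}"]) auto
next
  case False
  define A where "A = {a. \<exists>u. (\<alpha>, u, a) \<in> P \<and> {u, v} \<in> edges F}"
  have "A \<subseteq> (\<lambda>u. THE a. (\<alpha>, u, a) \<in> P) ` {u. {v, u} \<in> edges F}"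
  proof
    fix a assume "a \<in> A"
    then obtain u where u: "(\<alpha>, u, a) \<in> P" "{v, u} \<in> edges F" by (auto simp: A_def insert_commute)
    then have "(THE a. (\<alpha>, u, a) \<in> P) = a" using P(1) by (auto simp: valid_def)
    then show "a \<in> (\<lambda>u. THE a. (\<alpha>, u, a) \<in> P) ` {u. {v, u} \<in> edges F}" using u by blast
  qed
  then have finA: "finite A" using finite_nbrs finite_surj by blast
  have AG: "A \<subseteq> carrier G" using valid_carrier[OF P(1)] by (auto simp: A_def)
  \<comment> \<open>The second part consists of the \<open>g\<close> whose difference
    \<open>inv a \<otimes> g\<close> to a neighbour's value is an old difference
    \<open>d\<close>.\<close>
  define E where "E = (\<lambda>(\<beta>, u, a). a) ` P \<union> (\<lambda>(a, d). a \<otimes> d) ` (A \<times> diff_val ` diffs P)"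
  have "E \<prec> carrier G"
    unfolding E_def
    by (intro lesspoll_Un lesspoll_trans1[OF image_lepoll] lesspoll_Times P(2) infinite_G
        finite_lesspoll_infinite finA small_diff_val)
  then obtain g where g: "g \<in> carrier G" "g \<notin> E"
    and avoid: "\<And>a b. a \<in> A \<Longrightarrow> b \<in> A \<Longrightarrow> a \<noteq> b \<Longrightarrow> g \<otimes> inv a \<otimes> g \<noteq> b"
    using ex_avoiding[OF infinite_G finA AG] by metis
  have "valid (insert (\<alpha>, v, g) P)"
  proof (rule valid_insert[OF P(1) \<alpha> v g(1)])
    show "(\<alpha>, v, a) \<notin> P" for a using False by blast
    show "(\<alpha>, u, g) \<notin> P" for u using g(2) unfolding E_def by force
    show "inv a \<otimes> g \<notin> diff_val ` diffs P" if "(\<alpha>, u, a) \<in> P" "{u, v} \<in> edges F" for u a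
    proof
      assume *: "inv a \<otimes> g \<in> diff_val ` diffs P"
      have "a \<in> A" using that by (auto simp: A_def)
      then have "a \<otimes> (inv a \<otimes> g) \<in> E" using * unfolding E_def by blast
      moreover have "a \<otimes> (inv a \<otimes> g) = g" using g(1) \<open>a \<in> A\<close> AG by (auto simp flip: m_assoc)
      ultimately show False using g(2) by simp
    qed
    show "g \<otimes> inv a \<otimes> g \<noteq> b" if "(\<alpha>, u, a) \<in> P" "(\<alpha>, u', b) \<in> P" "{u, v} \<in> edges F"
      "{u', v} \<in> edges F" "a \<noteq> b" for u u' a b
      using that by (intro avoid) (auto simp: A_def)
  qed
  then show ?thesis by (intro exI[of _ "{(\<alpha>, v, g)}"]) auto
qed

text \<open>Each triple in \<open>P\<close> rules out one vertex and its finitely many neighbours,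
  so some vertex remains. Sending it to \<open>g\<close> creates no difference.\<close>

lemma extend_value:
  assumes P: "valid P" "P \<prec> carrier G" and \<alpha>: "\<alpha> \<in> carrier G" and g: "g \<in> carrier G"
  shows "\<exists>Q. finite Q \<and> valid (P \<union> Q) \<and> (\<exists>v. (\<alpha>, v, g) \<in> P \<union> Q)"
proof (cases "\<exists>v. (\<alpha>, v, g) \<in> P")
  case True
  then show ?thesis using P by (intro exI[of _ "{}"]) auto
next
  case False
  have "(\<Union>(\<beta>, u, a)\<in>P. insert u {v. {u, v} \<in> edges F}) \<prec> carrier G"
    using finite_nbrs by (intro finite_UN_lesspoll infinite_G P(2)) auto
  then have "(\<Union>(\<beta>, u, a)\<in>P. insert u {v. {u, v} \<in> edges F}) \<prec> verts F"
    using size eqpoll_sym lesspoll_eq_trans by blast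
  then obtain v where v: "v \<in> verts F" "v \<notin> (\<Union>(\<beta>, u, a)\<in>P. insert u {v. {u, v} \<in> edges F})"
    using ex_notin_lesspoll by blast
  have "valid (insert (\<alpha>, v, g) P)"
    by (rule valid_insert[OF P(1) \<alpha> v(1) g]) (use v(2) False in fastforce)+
  then show ?thesis by (intro exI[of _ "{(\<alpha>, v, g)}"]) auto
qed

text \<open>Fewer than \<open>|G|\<close> indices occur in \<open>P\<close>. At a fresh index an
  edge is sent to \<open>\<one>\<close> and \<open>d\<close>, which adds only \<open>d\<close> and
  its inverse as differences.\<close>

lemma extend_difference:
  assumes P: "valid P" "P \<prec> carrier G" and d: "d \<in> carrier G" "d \<noteq> \<one>"
  shows "\<exists>Q. finite Q \<and> valid (P \<union> Q) \<and> d \<in> diff_val ` diffs (P \<union> Q)"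
proof (cases "d \<in> diff_val ` diffs P")
  case True
  then show ?thesis using P by (intro exI[of _ "{}"]) auto
next
  case False
  have "(\<lambda>(\<alpha>, u, a). \<alpha>) ` P \<prec> carrier G" using P(2) by (intro lesspoll_trans1[OF image_lepoll])
  then obtain \<alpha> where \<alpha>: "\<alpha> \<in> carrier G" "\<alpha> \<notin> (\<lambda>(\<alpha>, u, a). \<alpha>) ` P"
    using ex_notin_lesspoll by blast
  then have new: "(\<alpha>, u, a) \<notin> P" for u a by force
  obtain u v where uv: "{u, v} \<in> edges F"
    using nontrivial simple unfolding simple_graph_def by (metis card_2_iff all_not_in_conv)
  have u: "u \<in> verts F" "v \<in> verts F" "u \<noteq> v" using edge_verts[OF uv] by auto
  define P1 where "P1 = insert (\<alpha>, u, \<one>) P"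
  have P1: "valid P1"
    unfolding P1_def by (rule valid_insert[OF P(1) \<alpha>(1) u(1) one_closed]) (use new in auto)
  have diffs1: "diffs P1 = diffs P"
  proof
    show "diffs P1 \<subseteq> diffs P"
      using new edge_verts unfolding diffs_def P1_def by blast
    show "diffs P \<subseteq> diffs P1" by (rule diffs_mono) (auto simp: P1_def)
  qed
  have "valid (insert (\<alpha>, v, d) P1)"
  proof (rule valid_insert[OF P1 \<alpha>(1) u(2) d(1)])
    have only: "w = u \<and> a = \<one>" if "(\<alpha>, w, a) \<in> P1" for w a
      using that new by (auto simp: P1_def)
    show "(\<alpha>, v, a) \<notin> P1" for a using only u(3) by blast
    show "(\<alpha>, w, d) \<notin> P1" for w using only d(2) by blast
    show "inv a \<otimes> d \<notin> diff_val ` diffs P1" if "(\<alpha>, w, a) \<in> P1" for w a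
      using only[OF that] False d(1) by (simp add: diffs1)
    show "d \<otimes> inv a \<otimes> d \<noteq> b" if "(\<alpha>, w, a) \<in> P1" "(\<alpha>, w', b) \<in> P1" "a \<noteq> b" for w w' a b
      using only[OF that(1)] only[OF that(2)] that(3) by simp
  qed
  moreover have "(\<alpha>, u, v, inv \<one> \<otimes> d) \<in> diffs (insert (\<alpha>, v, d) P1)"
    using uv by (intro diffsI) (auto simp: P1_def)
  then have "d \<in> diff_val ` diffs (insert (\<alpha>, v, d) P1)" using d(1) by force
  moreover have "insert (\<alpha>, v, d) P1 = P \<union> {(\<alpha>, v, d), (\<alpha>, u, \<one>)}" by (auto simp: P1_def)
  ultimately show ?thesis by (intro exI[of _ "{(\<alpha>, v, d), (\<alpha>, u, \<one>)}"]) simp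
qed

text \<open>One triple of \<open>R\<close> bundles three requirements: index \<alpha> is defined at
  \<open>v\<close>, it takes the value \<open>g\<close>, and \<open>g\<close> is a difference. As
  \<open>R\<close> is no larger than \<open>G\<close>, every stage stays below
  \<open>|G|\<close>.\<close>

lemma ex_complete:
  obtains P where "valid P"
    "\<And>\<alpha> v. \<alpha> \<in> carrier G \<Longrightarrow> v \<in> verts F \<Longrightarrow> \<exists>a. (\<alpha>, v, a) \<in> P"
    "\<And>\<alpha> g. \<alpha> \<in> carrier G \<Longrightarrow> g \<in> carrier G \<Longrightarrow> \<exists>v. (\<alpha>, v, g) \<in> P"
    "\<And>d. d \<in> carrier G \<Longrightarrow> d \<noteq> \<one> \<Longrightarrow> d \<in> diff_val ` diffs P"
proof -
  define R where "R = carrier G \<times> verts F \<times> carrier G"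
  define sat where "sat r P \<longleftrightarrow> (case r of (\<alpha>, v, g) \<Rightarrow>
    (\<exists>a. (\<alpha>, v, a) \<in> P) \<and> (\<exists>v. (\<alpha>, v, g) \<in> P) \<and> (g \<noteq> \<one> \<longrightarrow> g \<in> diff_val ` diffs P))" for r P
  have verts: "verts F \<noteq> {}" using size infinite_G eqpoll_finite_iff finite.emptyI by metis
  have sq: "carrier G \<times> carrier G \<approx> carrier G"
    using card_of_Times_same_infinite[OF infinite_G] by (simp add: eqpoll_iff_card_of_ordIso)
  have "R \<lesssim> carrier G \<times> (carrier G \<times> carrier G)"
    unfolding R_def using size by (intro times_lepoll_mono lepoll_refl) (simp add: eqpoll_imp_lepoll)
  also have "carrier G \<times> (carrier G \<times> carrier G) \<lesssim> carrier G \<times> carrier G"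
    using sq by (intro times_lepoll_mono lepoll_refl) (simp add: eqpoll_imp_lepoll)
  also have "carrier G \<times> carrier G \<lesssim> carrier G" using sq by (rule eqpoll_imp_lepoll)
  finally have R: "R \<lesssim> carrier G" .
  have infR: "infinite R"
    unfolding R_def using infinite_G verts by (auto simp: finite_cartesian_product_iff)
  obtain P where "valid P" and sat: "\<And>r. r \<in> R \<Longrightarrow> sat r P"
  proof (rule transfinite_extension[OF infR, of valid sat])
    fix P r assume P: "valid P" "P \<prec> R" and "r \<in> R"
    then obtain \<alpha> v g where r: "r = (\<alpha>, v, g)" and rG: "\<alpha> \<in> carrier G" "v \<in> verts F" "g \<in> carrier G"
      by (auto simp: R_def)
    have small: "P \<union> Q \<prec> carrier G" if "finite Q" for Q
      by (intro lesspoll_Un infinite_G finite_lesspoll_infinite that lesspoll_trans2[OF P(2) R])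
    obtain Q1 where Q1: "finite Q1" "valid (P \<union> Q1)" "\<exists>a. (\<alpha>, v, a) \<in> P \<union> Q1"
      using extend_vertex[OF P(1) _ rG(1,2)] small[of "{}"] by auto
    obtain Q2 where Q2: "finite Q2" "valid (P \<union> Q1 \<union> Q2)" "\<exists>v. (\<alpha>, v, g) \<in> P \<union> Q1 \<union> Q2"
      using extend_value[OF Q1(2) small rG(1,3)] Q1(1) by auto
    obtain Q3 where Q3: "finite Q3" "valid (P \<union> Q1 \<union> Q2 \<union> Q3)"
      "g \<noteq> \<one> \<longrightarrow> g \<in> diff_val ` diffs (P \<union> Q1 \<union> Q2 \<union> Q3)"
    proof (cases "g = \<one>")
      case True
      then show ?thesis using that[of "{}"] Q2(2) by simp
    next
      case False
      have "P \<union> Q1 \<union> Q2 \<prec> carrier G" using small[of "Q1 \<union> Q2"] Q1(1) Q2(1) by (simp add: Un_assoc)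
      from extend_difference[OF Q2(2) this rG(3) False] show ?thesis using that by blast
    qed
    have "sat r (P \<union> (Q1 \<union> Q2 \<union> Q3))"
      using Q1(3) Q2(3) Q3(3) unfolding sat_def r Un_assoc by blast
    then show "\<exists>Q. finite Q \<and> valid (P \<union> Q) \<and> sat r (P \<union> Q)"
      using Q1(1) Q2(1) Q3(1,2) by (intro exI[of _ "Q1 \<union> Q2 \<union> Q3"]) (simp add: Un_assoc)
  next
    fix r P P' assume "sat r P" "P \<subseteq> P'"
    then show "sat r P'" using diffs_mono[of P P'] unfolding sat_def by (cases r) blast
  qed (use valid_Union in blast)+
  show ?thesis
  proof (rule that[OF \<open>valid P\<close>])
    show "\<exists>a. (\<alpha>, v, a) \<in> P" if "\<alpha> \<in> carrier G" "v \<in> verts F" for \<alpha> v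
      \<comment> \<open>A component on which the claim does not depend may be any member of its set,
        here \<alpha> itself.\<close>
      using sat[of "(\<alpha>, v, \<alpha>)"] that by (simp add: R_def sat_def)
    show "\<exists>v. (\<alpha>, v, g) \<in> P" if "\<alpha> \<in> carrier G" "g \<in> carrier G" for \<alpha> g
      using sat[of "(\<alpha>, _, g)"] that verts unfolding R_def sat_def by blast
    show "d \<in> diff_val ` diffs P" if "d \<in> carrier G" "d \<noteq> \<one>" for d
      using sat[of "(d, _, d)"] that verts unfolding R_def sat_def by blast
  qed
qed

lemma ex_base_blocks:
  obtains f :: "'g \<Rightarrow> 'w \<Rightarrow> 'g" where
    "\<And>\<alpha>. \<alpha> \<in> carrier G \<Longrightarrow> bij_betw (f \<alpha>) (verts F) (carrier G)"
    "\<And>d. d \<in> carrier G \<Longrightarrow> d \<noteq> \<one> \<Longrightarrow>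
       \<exists>\<alpha>\<in>carrier G. \<exists>u v. {u, v} \<in> edges F \<and> inv (f \<alpha> u) \<otimes> f \<alpha> v = d"
    "\<And>\<alpha> \<beta> u v u' v'. \<alpha> \<in> carrier G \<Longrightarrow> \<beta> \<in> carrier G \<Longrightarrow> {u, v} \<in> edges F \<Longrightarrow>
       {u', v'} \<in> edges F \<Longrightarrow> inv (f \<alpha> u) \<otimes> f \<alpha> v = inv (f \<beta> u') \<otimes> f \<beta> v' \<Longrightarrow>
       \<alpha> = \<beta> \<and> u = u' \<and> v = v'"
proof -
  obtain P where P: "valid P"
    and vert: "\<And>\<alpha> v. \<alpha> \<in> carrier G \<Longrightarrow> v \<in> verts F \<Longrightarrow> \<exists>a. (\<alpha>, v, a) \<in> P"
    and val: "\<And>\<alpha> g. \<alpha> \<in> carrier G \<Longrightarrow> g \<in> carrier G \<Longrightarrow> \<exists>v. (\<alpha>, v, g) \<in> P"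
    and diff: "\<And>d. d \<in> carrier G \<Longrightarrow> d \<noteq> \<one> \<Longrightarrow> d \<in> diff_val ` diffs P"
    using ex_complete by blast
  define f where "f \<alpha> v = (THE a. (\<alpha>, v, a) \<in> P)" for \<alpha> v
  have f_eq: "f \<alpha> v = a" if "(\<alpha>, v, a) \<in> P" for \<alpha> v a
    using that P unfolding f_def valid_def by blast
  have f: "(\<alpha>, v, f \<alpha> v) \<in> P" if "\<alpha> \<in> carrier G" "v \<in> verts F" for \<alpha> v
    using vert[OF that] f_eq by blast
  have f_diff: "(\<alpha>, u, v, inv (f \<alpha> u) \<otimes> f \<alpha> v) \<in> diffs P"
    if "\<alpha> \<in> carrier G" "{u, v} \<in> edges F" for \<alpha> u v
    using edge_verts[OF that(2)] that by (intro diffsI f) auto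
  show ?thesis
  proof (rule that[of f])
    fix \<alpha> assume \<alpha>: "\<alpha> \<in> carrier G"
    show "bij_betw (f \<alpha>) (verts F) (carrier G)"
      unfolding bij_betw_def
    proof (intro conjI equalityI subsetI)
      show "inj_on (f \<alpha>) (verts F)"
      proof (rule inj_onI)
        fix u v assume "u \<in> verts F" "v \<in> verts F" "f \<alpha> u = f \<alpha> v"
        then have "(\<alpha>, u, f \<alpha> u) \<in> P" "(\<alpha>, v, f \<alpha> u) \<in> P" using f \<alpha> by metis+
        then show "u = v" using P unfolding valid_def by blast
      qed
      show "g \<in> carrier G" if "g \<in> f \<alpha> ` verts F" for g
        using that f[OF \<alpha>] valid_carrier[OF P] by blast
      show "g \<in> f \<alpha> ` verts F" if "g \<in> carrier G" for g
        using val[OF \<alpha> that] f_eq valid_carrier[OF P] by blast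
    qed
  next
    fix d assume "d \<in> carrier G" "d \<noteq> \<one>"
    from diff[OF this] obtain \<alpha> u v a b where "(\<alpha>, u, a) \<in> P" "(\<alpha>, v, b) \<in> P"
      "{u, v} \<in> edges F" "d = inv a \<otimes> b"
      unfolding diffs_def by force
    then show "\<exists>\<alpha>\<in>carrier G. \<exists>u v. {u, v} \<in> edges F \<and> inv (f \<alpha> u) \<otimes> f \<alpha> v = d"
      using valid_carrier[OF P] f_eq by metis
  next
    fix \<alpha> \<beta> u v u' v'
    assume G: "\<alpha> \<in> carrier G" "\<beta> \<in> carrier G" and e: "{u, v} \<in> edges F" "{u', v'} \<in> edges F"
      and eq: "inv (f \<alpha> u) \<otimes> f \<alpha> v = inv (f \<beta> u') \<otimes> f \<beta> v'"
    have "inj_on diff_val (diffs P)" using P by (simp add: valid_def)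
    from inj_onD[OF this _ f_diff[OF G(1) e(1)] f_diff[OF G(2) e(2)]]
    show "\<alpha> = \<beta> \<and> u = u' \<and> v = v'" using eq by simp
  qed
qed

end

section \<open>The solution\<close>

lemma graph_isomorphic_image:
  assumes F: "simple_graph F" and k: "inj_on k (verts F)"
  shows "graph_isomorphic (graph_image k F) F"
  unfolding graph_isomorphic_def
proof (intro exI conjI ballI)
  let ?f = "inv_into (verts F) k"
  show "bij_betw ?f (verts (graph_image k F)) (verts F)"
    using k by (simp add: graph_image_def bij_betw_inv_into inj_on_imp_bij_betw)
  fix x y assume "x \<in> verts (graph_image k F)" "y \<in> verts (graph_image k F)"
  then obtain u v where uv: "u \<in> verts F" "v \<in> verts F" "x = k u" "y = k v"
    by (auto simp: graph_image_def)
  have "{x, y} \<in> edges (graph_image k F) \<longleftrightarrow> (\<exists>e\<in>edges F. k ` {u, v} = k ` e)"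
    using uv by (auto simp: graph_image_def)
  also have "\<dots> \<longleftrightarrow> {u, v} \<in> edges F"
    using inj_on_image_eq_iff[OF k, of "{u, v}"] F uv unfolding simple_graph_def by blast
  finally show "{x, y} \<in> edges (graph_image k F) \<longleftrightarrow> {?f x, ?f y} \<in> edges F"
    using k uv by simp
qed

lemma spanning_subgraph_image:
  assumes F: "simple_graph F" and k: "bij_betw k (verts F) V"
  shows "spanning_subgraph (graph_image k F) (complete_graph V)"
proof -
  have e: "k ` e \<subseteq> V \<and> card (k ` e) = 2" if "e \<in> edges F" for e
    using that F k unfolding simple_graph_def bij_betw_def by (metis card_image image_mono inj_on_subset)
  then have "k ` e \<in> edges (complete_graph V)" if "e \<in> edges F" for e
    using e[OF that] by (fastforce simp: complete_graph_def card_2_iff)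
  then show ?thesis
    using e k by (auto simp: spanning_subgraph_def simple_graph_def graph_image_def
        complete_graph_def bij_betw_def)
qed

text \<open>Translations are restricted to the carrier because \<open>Bij\<close> consists of
  extensional maps.\<close>

lemma (in group) left_mult_sharply_transitive:
  "sharply_transitive_action G (carrier G) (\<lambda>g. \<lambda>x\<in>carrier G. g \<otimes> x)"
proof -
  let ?\<phi> = "\<lambda>g. \<lambda>x\<in>carrier G. g \<otimes> x"
  have bij: "?\<phi> g \<in> Bij (carrier G)" if g: "g \<in> carrier G" for g
  proof -
    have "bij_betw (\<lambda>x. g \<otimes> x) (carrier G) (carrier G)"
      using g by (intro bij_betwI[of _ _ _ "\<lambda>x. inv g \<otimes> x"]) (auto simp flip: m_assoc)
    then show ?thesis by (simp add: Bij_def bij_betw_restrict_eq)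
  qed
  have "?\<phi> \<in> hom G (BijGroup (carrier G))"
    using bij by (auto simp: hom_def BijGroup_def compose_def m_assoc intro!: restrict_ext)
  then have "group_action G (carrier G) ?\<phi>"
    by (simp add: group_action_def group_hom_def group_hom_axioms_def group_BijGroup is_group)
  moreover have "\<exists>!g. g \<in> carrier G \<and> ?\<phi> g x = y" if "x \<in> carrier G" "y \<in> carrier G" for x y
  proof (rule ex1I)
    show "y \<otimes> inv x \<in> carrier G \<and> ?\<phi> (y \<otimes> inv x) x = y" using that by (simp add: m_assoc)
    show "g = y \<otimes> inv x" if "g \<in> carrier G \<and> ?\<phi> g x = y" for g
      using that \<open>x \<in> carrier G\<close> by (auto simp: m_assoc)
  qed
  ultimately show ?thesis by (simp add: sharply_transitive_action_def)
qed

text \<open>The difference of an ordered pair \<open>(x, y)\<close> singles out one oriented edge of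
  one base block, and exactly one left translation carries that edge to the pair.\<close>

lemma (in oberwolfach) ex_regular_solution:
  "\<exists>\<C>. OP_solution F (carrier G) \<C> \<and> regular_family G (carrier G) \<C>"
proof -
  obtain f :: "'g \<Rightarrow> 'w \<Rightarrow> 'g" where
    bij: "\<And>\<alpha>. \<alpha> \<in> carrier G \<Longrightarrow> bij_betw (f \<alpha>) (verts F) (carrier G)"
    and ex: "\<And>d. d \<in> carrier G \<Longrightarrow> d \<noteq> \<one> \<Longrightarrow>
       \<exists>\<alpha>\<in>carrier G. \<exists>u v. {u, v} \<in> edges F \<and> inv (f \<alpha> u) \<otimes> f \<alpha> v = d"
    and uniq: "\<And>\<alpha> \<beta> u v u' v'. \<alpha> \<in> carrier G \<Longrightarrow> \<beta> \<in> carrier G \<Longrightarrow> {u, v} \<in> edges F \<Longrightarrow>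
       {u', v'} \<in> edges F \<Longrightarrow> inv (f \<alpha> u) \<otimes> f \<alpha> v = inv (f \<beta> u') \<otimes> f \<beta> v' \<Longrightarrow>
       \<alpha> = \<beta> \<and> u = u' \<and> v = v'"
    using ex_base_blocks by blast
  have fG: "f \<alpha> v \<in> carrier G" if "\<alpha> \<in> carrier G" "v \<in> verts F" for \<alpha> v
    using bij that bij_betwE by blast
  define B where "B \<alpha> h = graph_image (\<lambda>v. h \<otimes> f \<alpha> v) F" for \<alpha> h
  define \<C> where "\<C> = (\<lambda>(\<alpha>, h). B \<alpha> h) ` (carrier G \<times> carrier G)"
  have bij_h: "bij_betw (\<lambda>v. h \<otimes> f \<alpha> v) (verts F) (carrier G)"
    if "\<alpha> \<in> carrier G" "h \<in> carrier G" for \<alpha> h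
  proof -
    have "bij_betw (\<lambda>x. h \<otimes> x) (carrier G) (carrier G)"
      using that by (intro bij_betwI[of _ _ _ "\<lambda>x. inv h \<otimes> x"]) (auto simp flip: m_assoc)
    from bij_betw_trans[OF bij[OF that(1)] this] show ?thesis by (simp add: comp_def)
  qed
  have edge_B: "\<exists>u v. {u, v} \<in> edges F \<and> x = h \<otimes> f \<alpha> u \<and> y = h \<otimes> f \<alpha> v"
    if xy: "{x, y} \<in> edges (B \<alpha> h)" for \<alpha> h x y
  proof -
    obtain e where e: "e \<in> edges F" "{x, y} = (\<lambda>v. h \<otimes> f \<alpha> v) ` e"
      using xy by (auto simp: B_def graph_image_def)
    then obtain u v where "e = {u, v}" using simple by (auto simp: simple_graph_def card_2_iff)
    then show ?thesis using e by (auto simp: doubleton_eq_iff) (metis insert_commute)+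
  qed
  \<comment> \<open>Left translation preserves differences, as \<open>h\<close> cancels.\<close>
  have same: "inv (f \<alpha> u) \<otimes> f \<alpha> v = inv x \<otimes> y"
    if "\<alpha> \<in> carrier G" "h \<in> carrier G" "{u, v} \<in> edges F" "x = h \<otimes> f \<alpha> u" "y = h \<otimes> f \<alpha> v"
    for \<alpha> h u v x y
    using that fG edge_verts[OF that(3)]
    by (simp add: inv_mult_group m_assoc) (simp flip: m_assoc)
  have unique: "\<exists>!B. B \<in> \<C> \<and> e \<in> edges B" if e: "e \<in> edges (complete_graph (carrier G))" for e
  proof -
    obtain x y where xy: "e = {x, y}" "x \<in> carrier G" "y \<in> carrier G" "x \<noteq> y"
      using e by (auto simp: complete_graph_def)
    have "inv x \<otimes> y \<noteq> \<one>" using xy by (metis inv_equality inv_inv inv_closed)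
    then obtain \<alpha> u v where \<alpha>: "\<alpha> \<in> carrier G" and uv: "{u, v} \<in> edges F"
      and d: "inv (f \<alpha> u) \<otimes> f \<alpha> v = inv x \<otimes> y"
      using ex[of "inv x \<otimes> y"] xy by auto
    have uvG: "f \<alpha> u \<in> carrier G" "f \<alpha> v \<in> carrier G" using fG \<alpha> edge_verts[OF uv] by auto
    \<comment> \<open>The only translation taking \<open>f \<alpha> u\<close> to \<open>x\<close>;
      equality of differences then makes it take \<open>f \<alpha> v\<close> to
      \<open>y\<close>.\<close>
    define h where "h = x \<otimes> inv (f \<alpha> u)"
    have h: "h \<in> carrier G" "h \<otimes> f \<alpha> u = x" using xy uvG by (simp_all add: h_def m_assoc)
    have "h \<otimes> f \<alpha> v = x \<otimes> (inv (f \<alpha> u) \<otimes> f \<alpha> v)" using xy uvG by (simp add: h_def m_assoc)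
    then have hv: "h \<otimes> f \<alpha> v = y" using xy by (simp add: d flip: m_assoc)
    show ?thesis
    proof (rule ex1I[of _ "B \<alpha> h"])
      have "e = (\<lambda>v. h \<otimes> f \<alpha> v) ` {u, v}" using xy h hv by simp
      then have "e \<in> edges (B \<alpha> h)" unfolding B_def graph_image_def using uv by (simp del: image_insert)
      then show "B \<alpha> h \<in> \<C> \<and> e \<in> edges (B \<alpha> h)" using \<alpha> h by (auto simp: \<C>_def)
      fix B' assume "B' \<in> \<C> \<and> e \<in> edges B'"
      then obtain \<beta> k where \<beta>: "\<beta> \<in> carrier G" "k \<in> carrier G" "B' = B \<beta> k"
        and "{x, y} \<in> edges (B \<beta> k)"
        using xy by (auto simp: \<C>_def)
      then obtain u' v' where uv': "{u', v'} \<in> edges F" "x = k \<otimes> f \<beta> u'" "y = k \<otimes> f \<beta> v'"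
        using edge_B by blast
      then have eq: "\<beta> = \<alpha> \<and> u' = u \<and> v' = v"
        using same[OF \<beta>(1,2) uv'] d by (intro uniq \<alpha> \<beta> uv uv') simp
      then have "k \<otimes> f \<alpha> u = h \<otimes> f \<alpha> u" using uv' h by simp
      then have "k = h" using right_cancel[OF uvG(1) \<beta>(2) h(1)] by blast
      then show "B' = B \<alpha> h" using \<beta>(3) eq by simp
    qed
  qed
  have "OP_solution F (carrier G) \<C>"
    unfolding OP_solution_def
  proof (intro conjI ballI unique)
    show "carrier G \<approx> verts F" using size by (rule eqpoll_sym)
    fix C assume "C \<in> \<C>"
    then obtain \<alpha> h where C: "\<alpha> \<in> carrier G" "h \<in> carrier G" "C = B \<alpha> h" by (auto simp: \<C>_def)
    show "spanning_subgraph C (complete_graph (carrier G))"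
      unfolding C B_def by (intro spanning_subgraph_image simple bij_h C)
    show "graph_isomorphic C F"
      unfolding C B_def
      by (intro graph_isomorphic_image simple bij_betw_imp_inj_on[OF bij_h] C)
  qed
  moreover have "regular_family G (carrier G) \<C>"
    unfolding regular_family_def
  proof (intro exI conjI ballI)
    show "sharply_transitive_action G (carrier G) (\<lambda>g. \<lambda>x\<in>carrier G. g \<otimes> x)"
      by (rule left_mult_sharply_transitive)
    fix g C assume g: "g \<in> carrier G" and "C \<in> \<C>"
    then obtain \<alpha> h where C: "\<alpha> \<in> carrier G" "h \<in> carrier G" "C = B \<alpha> h" by (auto simp: \<C>_def)
    \<comment> \<open>Translating by \<open>g\<close> turns the block with parameters \<alpha> and
      \<open>h\<close> into the one with \<alpha> and \<open>g \<otimes> h\<close>.\<close>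
    have img: "(\<lambda>x\<in>carrier G. g \<otimes> x) ` (\<lambda>v. h \<otimes> f \<alpha> v) ` e = (\<lambda>v. (g \<otimes> h) \<otimes> f \<alpha> v) ` e"
      if "e \<subseteq> verts F" for e
      unfolding image_image using that fG g C by (intro image_cong) (auto simp: m_assoc)
    have "e \<subseteq> verts F" if "e \<in> edges F" for e using that simple by (auto simp: simple_graph_def)
    then have "graph_image (\<lambda>x\<in>carrier G. g \<otimes> x) C = B \<alpha> (g \<otimes> h)"
      using img unfolding C B_def graph_image_def by (simp add: image_comp comp_def cong: image_cong_simp)
    then show "graph_image (\<lambda>x\<in>carrier G. g \<otimes> x) C \<in> \<C>" using g C by (auto simp: \<C>_def)
  qed
  ultimately show ?thesis by blast
qed

theorem theorem3p12:
  fixes G :: "('g, 'm) monoid_scheme"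
    and F :: "'w sgraph"
  assumes "group G"
    and "infinite (carrier G)"
    and "involution_free G"
    and "simple_graph F"
    and "edges F \<noteq> {}"
    and "locally_finite F"
    and "verts F \<approx> carrier G"
  shows "\<exists>(V :: 'g set) \<C>. OP_solution F V \<C> \<and> regular_family G V \<C>"
proof -
  interpret group G by fact
  interpret oberwolfach G F by unfold_locales (use assms in auto)
  show ?thesis using ex_regular_solution by blast
qed

end
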